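(* Let $g(x)=1+g_1x+g_2x^2+\cdots$ and $f(x)=x+f_2x^2+f_3x^3+\cdots$ be formal power series in $\mathbb{C}[[x]]$, let $M=(g(x),f(x))$ be the corresponding Riordan array, and let $\bar f(x)$ be the compositional inverse of $f(x)$. Let $\tilde P_M$ be the second production matrix of $M$, that is, the matrix $M^{-1}\overline{\overline{M}}$ with its first column removed. Then the matrix $\tilde M$ produced by $\tilde P_M$ is the Riordan array $$\tilde M=\left(\frac{\bar f(x)}{x\,g(\bar f(x))},\ \frac{\bar f(x)^2}{x}\right)^{-1}.$$
   Context: For formal power series $g(x)=g_0+g_1x+\cdots$ with $g_0\neq 0$ and $f(x)=f_1x+f_2x^2+\cdots$ with $f_1\neq 0$, the Riordan array $(g(x),f(x))$ is the infinite lower-triangular matrix $M=(M_{n,k})_{n,k\ge 0}$ with $M_{n,k}=[x^n]\,g(x)f(x)^k$. Such pairs form a group (the Riordan group) with product $(g,f)\cdot(u,v)=(g(x)\,u(f(x)),\,v(f(x)))$ and inverse $(g,f)^{-1}=\left(\frac{1}{g(\bar f(x))},\bar f(x)\right)$, where $\bar f$ is the compositional inverse of $f$ ($f(\bar f(x))=\bar f(f(x))=x$); these operations correspond to matrix multiplication and matrix inversion. For an infinite matrix $X$ with rows and columns indexed by $0,1,2,\dots$, $\overline{X}$ denotes $X$ with its top row removed, and $\overline{\overline{X}}$ denotes $X$ with its top two rows removed. The production matrix of an invertible lower-triangular matrix $X$ is $P_X=X^{-1}\overline{X}$. Given a row-finite infinite matrix $P$, the matrix produced (generated) by $P$ is the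 unique matrix $X$ whose top row is $(1,0,0,\dots)$ and which satisfies $\overline{X}=XP$, i.e. row $n+1$ of $X$ is row $n$ of $X$ times $P$. *)

theory Defs
  imports "HOL-Computational_Algebra.Computational_Algebra"
begin

unbundle fps_syntax

type_synonym 'a inf_matrix = "nat \<Rightarrow> nat \<Rightarrow> 'a"

definition row_finite :: "'a::zero inf_matrix \<Rightarrow> bool" where
  "row_finite A \<longleftrightarrow> (\<forall>n. finite {k. A n k \<noteq> 0})"

definition lower_triangular :: "'a::zero inf_matrix \<Rightarrow> bool" where
  "lower_triangular A \<longleftrightarrow> (\<forall>n k. n < k \<longrightarrow> A n k = 0)"

definition mat_one :: "'a::zero_neq_one inf_matrix" where
  "mat_one n k = (if n = k then 1 else 0)"

text \<open>The sum ranges over the support of a row of the left factor, so the product is the usual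
  one whenever the left factor is row-finite.\<close>

definition mat_mult :: "'a::semiring_0 inf_matrix \<Rightarrow> 'a inf_matrix \<Rightarrow> 'a inf_matrix" where
  "mat_mult A B n k = (\<Sum>j | A n j \<noteq> 0. A n j * B j k)"

text \<open>Row-finite matrices form a monoid, in which two-sided inverses are unique
  (\<open>mat_inverse_eqI\<close> below).\<close>

definition mat_inverse :: "'a::semiring_1 inf_matrix \<Rightarrow> 'a inf_matrix" where
  "mat_inverse A = (THE B. row_finite B \<and> mat_mult A B = mat_one \<and> mat_mult B A = mat_one)"

definition drop_top_row :: "'a inf_matrix \<Rightarrow> 'a inf_matrix" where
  "drop_top_row A = (\<lambda>n k. A (Suc n) k)"

definition drop_first_col :: "'a inf_matrix \<Rightarrow> 'a inf_matrix" where
  "drop_first_col A = (\<lambda>n k. A n (Suc k))"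

definition second_production_matrix ::
  "'a::semiring_1 inf_matrix \<Rightarrow> 'a inf_matrix" where
  "second_production_matrix A =
     drop_first_col (mat_mult (mat_inverse A) (drop_top_row (drop_top_row A)))"

text \<open>Meaningful for row-finite \<open>P\<close>; see \<open>ex1_produced\<close> below.\<close>

definition produced :: "'a::semiring_1 inf_matrix \<Rightarrow> 'a inf_matrix" where
  "produced P = (THE X. X 0 = (\<lambda>k. if k = 0 then 1 else 0) \<and> drop_top_row X = mat_mult X P)"

definition riordan_pair :: "'a::field fps \<times> 'a fps \<Rightarrow> bool" where
  "riordan_pair = (\<lambda>(g, f). g $ 0 \<noteq> 0 \<and> f $ 0 = 0 \<and> f $ 1 \<noteq> 0)"

definition riordan_array :: "'a::field fps \<times> 'a fps \<Rightarrow> 'a inf_matrix" where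
  "riordan_array = (\<lambda>(g, f) n k. (g * f ^ k) $ n)"

text \<open>Inverse in the Riordan group; \<open>mat_inverse_riordan_array\<close> below shows that it agrees with
  matrix inversion.\<close>

definition riordan_inverse :: "'a::field fps \<times> 'a fps \<Rightarrow> 'a fps \<times> 'a fps" where
  "riordan_inverse = (\<lambda>(g, f). (1 / (g oo fps_inv f), fps_inv f))"

lemma mat_mult_eq_sum:
  assumes "finite S" "{j. A n j \<noteq> 0} \<subseteq> S"
  shows "mat_mult A B n k = (\<Sum>j\<in>S. A n j * B j k)"
  unfolding mat_mult_def by (rule sum.mono_neutral_left) (use assms in auto)

lemma row_finite_mat_mult:
  assumes "row_finite A" "row_finite B"
  shows "row_finite (mat_mult A B)"
  unfolding row_finite_def
proof
  fix n
  have "{k. mat_mult A B n k \<noteq> 0} \<subseteq> (\<Union>j\<in>{j. A n j \<noteq> 0}. {k. B j k \<noteq> 0})"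
  proof
    fix k assume "k \<in> {k. mat_mult A B n k \<noteq> 0}"
    then have "(\<Sum>j | A n j \<noteq> 0. A n j * B j k) \<noteq> 0" by (simp add: mat_mult_def)
    then obtain j where "A n j \<noteq> 0" "A n j * B j k \<noteq> 0"
      by (metis (mono_tags, lifting) mem_Collect_eq sum.neutral)
    then show "k \<in> (\<Union>j\<in>{j. A n j \<noteq> 0}. {k. B j k \<noteq> 0})" by auto
  qed
  moreover have "finite (\<Union>j\<in>{j. A n j \<noteq> 0}. {k. B j k \<noteq> 0})"
    using assms by (auto simp: row_finite_def)
  ultimately show "finite {k. mat_mult A B n k \<noteq> 0}" by (rule finite_subset)
qed

lemma mat_mult_assoc:
  assumes "row_finite A" "row_finite B"
  shows "mat_mult (mat_mult A B) C = mat_mult A (mat_mult B C)"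
proof (intro ext)
  fix n k
  define S where "S = {j. A n j \<noteq> 0}"
  define T where "T = (\<Union>j\<in>S. {i. B j i \<noteq> 0})"
  have S: "finite S" using assms by (auto simp: S_def row_finite_def)
  have T: "finite T" using assms S by (auto simp: T_def row_finite_def)
  have "{i. mat_mult A B n i \<noteq> 0} \<subseteq> T"
  proof
    fix i assume "i \<in> {i. mat_mult A B n i \<noteq> 0}"
    then have "(\<Sum>j\<in>S. A n j * B j i) \<noteq> 0" by (simp add: mat_mult_def S_def)
    then obtain j where "j \<in> S" "A n j * B j i \<noteq> 0" by (metis (mono_tags, lifting) sum.neutral)
    then have "B j i \<noteq> 0" by auto
    with \<open>j \<in> S\<close> show "i \<in> T" by (auto simp: T_def)
  qed
  then have "mat_mult (mat_mult A B) C n k = (\<Sum>i\<in>T. mat_mult A B n i * C i k)"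
    by (intro mat_mult_eq_sum T)
  also have "\<dots> = (\<Sum>i\<in>T. \<Sum>j\<in>S. A n j * (B j i * C i k))"
    by (simp add: mat_mult_def S_def sum_distrib_right mult.assoc)
  also have "\<dots> = (\<Sum>j\<in>S. A n j * (\<Sum>i\<in>T. B j i * C i k))"
    by (subst sum.swap) (simp add: sum_distrib_left)
  also have "\<dots> = (\<Sum>j\<in>S. A n j * mat_mult B C j k)"
  proof (rule sum.cong)
    fix j assume "j \<in> S"
    then have "{i. B j i \<noteq> 0} \<subseteq> T" by (auto simp: T_def)
    then show "A n j * (\<Sum>i\<in>T. B j i * C i k) = A n j * mat_mult B C j k"
      using mat_mult_eq_sum[OF T] by metis
  qed simp
  finally show "mat_mult (mat_mult A B) C n k = mat_mult A (mat_mult B C) n k"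
    by (simp add: mat_mult_def S_def)
qed

lemma mat_mult_one_left: "mat_mult mat_one (A :: 'a::semiring_1 inf_matrix) = A"
proof (intro ext)
  fix n k
  show "mat_mult mat_one A n k = A n k"
    by (subst mat_mult_eq_sum[of "{n}"]) (auto simp: mat_one_def)
qed

lemma mat_mult_one_right:
  assumes "row_finite A"
  shows "mat_mult A (mat_one :: 'a::semiring_1 inf_matrix) = A"
proof (intro ext)
  fix n k
  have "mat_mult A mat_one n k = (\<Sum>j\<in>insert k {j. A n j \<noteq> 0}. A n j * mat_one j k)"
    using assms by (intro mat_mult_eq_sum) (auto simp: row_finite_def)
  also have "\<dots> = (\<Sum>j\<in>{k}. A n j * mat_one j k)"
    using assms by (intro sum.mono_neutral_right) (auto simp: row_finite_def mat_one_def)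
  finally show "mat_mult A mat_one n k = A n k" by (simp add: mat_one_def)
qed

lemma mat_inverse_eqI:
  fixes A B :: "'a::semiring_1 inf_matrix"
  assumes "row_finite A" "row_finite B" "mat_mult A B = mat_one" "mat_mult B A = mat_one"
  shows "mat_inverse A = B"
  unfolding mat_inverse_def
proof (rule the_equality)
  fix C assume C: "row_finite C \<and> mat_mult A C = mat_one \<and> mat_mult C A = mat_one"
  have "C = mat_mult C (mat_mult A B)" using C assms(3) by (metis mat_mult_one_right)
  also have "\<dots> = mat_mult (mat_mult C A) B" using C assms(1) by (metis mat_mult_assoc)
  finally show "C = B" using C by (simp add: mat_mult_one_left)
qed (use assms in auto)

lemma lower_triangular_imp_row_finite: "lower_triangular A \<Longrightarrow> row_finite A"
  unfolding lower_triangular_def row_finite_def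
proof (intro allI)
  fix n assume "\<forall>n k. n < k \<longrightarrow> A n k = 0"
  then have "{k. A n k \<noteq> 0} \<subseteq> {..n}" by (auto simp: not_less[symmetric])
  then show "finite {k. A n k \<noteq> 0}" by (rule finite_subset) simp
qed

lemma ex1_produced:
  fixes P :: "'a::semiring_1 inf_matrix"
  shows "\<exists>!X. X 0 = (\<lambda>k. if k = 0 then 1 else 0) \<and> drop_top_row X = mat_mult X P"
proof -
  define step where "step = (\<lambda>r k. \<Sum>j | r j \<noteq> 0. r j * P j k)"
  define X where "X = (\<lambda>n. (step ^^ n) (\<lambda>k. if k = 0 then 1 else 0))"
  have step: "drop_top_row Y = mat_mult Y P \<longleftrightarrow> (\<forall>n. Y (Suc n) = step (Y n))" for Y
    by (auto simp: fun_eq_iff drop_top_row_def mat_mult_def step_def)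
  show ?thesis
  proof (rule ex1I[of _ X])
    fix Y :: "'a inf_matrix"
    assume "Y 0 = (\<lambda>k. if k = 0 then 1 else 0) \<and> drop_top_row Y = mat_mult Y P"
    then have "Y n = X n" for n by (induction n) (auto simp: X_def step)
    then show "Y = X" by blast
  qed (auto simp: X_def step)
qed

lemma riordan_array_lower_triangular:
  assumes "f $ 0 = 0"
  shows "lower_triangular (riordan_array (g, f))"
  using assms by (auto simp: lower_triangular_def riordan_array_def fps_mult_nth
      startsby_zero_power_prefix intro!: sum.neutral)

lemma riordan_array_mult:
  assumes "f $ 0 = 0" "v $ 0 = 0"
  shows "mat_mult (riordan_array (g, f)) (riordan_array (u, v)) =
         riordan_array (g * (u oo f), v oo f)"
proof (intro ext)
  fix n k
  define h where "h = u * v ^ k"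
  have "mat_mult (riordan_array (g, f)) (riordan_array (u, v)) n k =
        (\<Sum>j\<le>n. riordan_array (g, f) n j * riordan_array (u, v) j k)"
    using riordan_array_lower_triangular[OF assms(1)]
    by (intro mat_mult_eq_sum) (auto simp: lower_triangular_def not_less[symmetric])
  also have "\<dots> = (\<Sum>j\<le>n. \<Sum>i\<le>n. h $ j * (g $ i * (f ^ j) $ (n - i)))"
    by (simp add: riordan_array_def h_def fps_mult_nth[of g] atMost_atLeast0
        sum_distrib_left sum_distrib_right mult_ac)
  also have "\<dots> = (\<Sum>i\<le>n. g $ i * (\<Sum>j\<le>n. h $ j * (f ^ j) $ (n - i)))"
    by (subst sum.swap) (simp add: sum_distrib_left mult_ac)
  also have "\<dots> = (\<Sum>i\<le>n. g $ i * (h oo f) $ (n - i))"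
  proof (rule sum.cong)
    fix i assume "i \<in> {..n}"
    have "(\<Sum>j\<le>n. h $ j * (f ^ j) $ (n - i)) = (\<Sum>j=0..n - i. h $ j * (f ^ j) $ (n - i))"
      using assms by (intro sum.mono_neutral_right) (auto simp: startsby_zero_power_prefix)
    then show "g $ i * (\<Sum>j\<le>n. h $ j * (f ^ j) $ (n - i)) = g $ i * (h oo f) $ (n - i)"
      by (simp add: fps_compose_nth)
  qed simp
  also have "\<dots> = (g * (h oo f)) $ n"
    by (simp add: fps_mult_nth atMost_atLeast0)
  also have "\<dots> = riordan_array (g * (u oo f), v oo f) n k"
    using assms by (simp add: h_def riordan_array_def fps_compose_mult_distrib
        fps_compose_power mult.assoc)
  finally show "mat_mult (riordan_array (g, f)) (riordan_array (u, v)) n k =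
      riordan_array (g * (u oo f), v oo f) n k" .
qed

lemma riordan_array_one: "riordan_array (1, fps_X) = mat_one"
  by (auto simp: riordan_array_def mat_one_def fun_eq_iff)

lemma mat_inverse_riordan_array:
  assumes "riordan_pair p"
  shows "mat_inverse (riordan_array p) = riordan_array (riordan_inverse p)"
proof -
  obtain g f where p: "p = (g, f)" by (cases p)
  have g: "g $ 0 \<noteq> 0" and f: "f $ 0 = 0" "f $ 1 \<noteq> 0"
    using assms by (auto simp: p riordan_pair_def)
  define h where "h = fps_inv f"
  have h: "h $ 0 = 0" by (simp add: h_def fps_inv_def)
  have hf: "h oo f = fps_X" and fh: "f oo h = fps_X"
    using f by (simp_all add: h_def fps_inv fps_inv_right)
  have gh: "(g oo h) $ 0 \<noteq> 0" using g by simp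
  have inv: "riordan_inverse p = (inverse (g oo h), h)"
    using gh by (simp add: riordan_inverse_def p h_def[symmetric] fps_divide_unit)
  have "g * (inverse (g oo h) oo f) = 1"
  proof -
    have "inverse (g oo h) oo f = inverse ((g oo h) oo f)"
      using f gh by (intro fps_inverse_compose) auto
    also have "(g oo h) oo f = g"
      using f h hf by (simp add: fps_compose_assoc[symmetric])
    finally show ?thesis using g by (simp add: inverse_mult_eq_1')
  qed
  moreover have "inverse (g oo h) * (g oo h) = 1" using gh by (rule inverse_mult_eq_1)
  ultimately show ?thesis
    unfolding inv unfolding p
    using f h hf fh by (intro mat_inverse_eqI lower_triangular_imp_row_finite
        riordan_array_lower_triangular) (simp_all add: riordan_array_mult riordan_array_one)
qed

lemma row_finite_second_production_matrix:
  assumes "riordan_pair p"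
  shows "row_finite (second_production_matrix (riordan_array p))"
proof -
  obtain g f where p: "p = (g, f)" by (cases p)
  have f: "f $ 0 = 0" using assms by (auto simp: p riordan_pair_def)
  have M: "row_finite (riordan_array p)"
    unfolding p by (intro lower_triangular_imp_row_finite riordan_array_lower_triangular f)
  have "row_finite (riordan_array (riordan_inverse p))"
    unfolding p riordan_inverse_def prod.case
    by (intro lower_triangular_imp_row_finite riordan_array_lower_triangular)
       (simp add: fps_inv_def)
  moreover have "row_finite (drop_top_row (drop_top_row (riordan_array p)))"
    using M by (auto simp: row_finite_def drop_top_row_def)
  ultimately have "row_finite (mat_mult (mat_inverse (riordan_array p))
      (drop_top_row (drop_top_row (riordan_array p))))" (is "row_finite ?A")
    using assms by (simp add: mat_inverse_riordan_array row_finite_mat_mult)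
  then have "finite (Suc -` {k. ?A n k \<noteq> 0})" for n
    by (intro finite_vimageI) (auto simp: row_finite_def)
  then show ?thesis
    by (simp add: row_finite_def second_production_matrix_def drop_first_col_def vimage_def)
qed

end

theory Submission
  imports Defs
begin

text \<open>
  Write \<open>f = x \<phi>(x)\<close> and let \<open>w\<close> be the power series with \<open>w = x \<phi>(w)\<close> that Lagrange inversion is
  about. With \<open>h\<close> the compositional inverse of \<open>f\<close> and \<open>F\<close> that of \<open>h\<^sup>2 / x\<close>, one has
  \<open>w = h(F)\<close>: indeed \<open>f(h(F)) = F\<close> and \<open>h(F)\<^sup>2 = x F\<close>, so that
  \<open>h(F) \<phi>(h(F)) = F\<close> and hence \<open>h(F) = x \<phi>(h(F))\<close>. In terms of \<open>w\<close>, the Riordan array of the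
  theorem is \<open>((g \<phi>)(w), f(w))\<close>, and two factorizations of this array give its production
  matrix.

  Removing the first row and the first column of a Riordan array \<open>(g, x \<psi>)\<close> gives
  \<open>(g \<psi>, x \<psi>)\<close>. Applied to \<open>M = (g, x \<phi>)\<close>, this says that the second production matrix is
  \<open>M\<^sup>-\<^sup>1\<close> times \<open>(g \<phi>, f)\<close> without its top row. Since
  \<open>((g \<phi>)(w), f(w)) = (\<phi>(w), w) \<cdot> M\<close>, multiplying by it leaves \<open>(\<phi>(w), w)\<close> times \<open>(g \<phi>, f)\<close> without
  its top row. Applied to \<open>(1, w)\<close> with \<open>w = x \<phi>(w)\<close>, the same fact says that \<open>(\<phi>(w), w)\<close> is
  \<open>(1, w)\<close> without its first row and column, and these can be put back because the first column of
  \<open>(1, w)\<close> is zero below the top. So the product is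
  \<open>(1, w) \<cdot> (g \<phi>, f) = ((g \<phi>)(w), f(w))\<close> without its top row, as required.
\<close>

section \<open>Products of infinite matrices without a row or a column\<close>

lemma drop_first_col_mat_mult:
  "drop_first_col (mat_mult A B) = mat_mult A (drop_first_col B)"
  by (simp add: drop_first_col_def mat_mult_def fun_eq_iff)

text \<open>The first column of the left factor meets only the top row of the right factor, so the two can
  be deleted together as soon as this column contributes nothing.\<close>

lemma drop_top_row_mat_mult_shift:
  assumes "row_finite A" "\<And>n. A (Suc n) 0 = 0"
  shows "drop_top_row (mat_mult A B) =
         mat_mult (drop_first_col (drop_top_row A)) (drop_top_row B)"
proof (intro ext)
  fix n k
  define S where "S = {j. A (Suc n) (Suc j) \<noteq> 0}"
  have supp: "{j. A (Suc n) j \<noteq> 0} = Suc ` S"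
    using assms(2) by (auto simp: S_def image_iff) (metis not0_implies_Suc)
  show "drop_top_row (mat_mult A B) n k =
        mat_mult (drop_first_col (drop_top_row A)) (drop_top_row B) n k"
    by (simp add: mat_mult_def drop_top_row_def drop_first_col_def supp sum.reindex
        flip: S_def)
qed

lemma produced_eqI:
  fixes P :: "'a::semiring_1 inf_matrix"
  assumes "X 0 = (\<lambda>k. if k = 0 then 1 else 0)" "drop_top_row X = mat_mult X P"
  shows "produced P = X"
  unfolding produced_def using assms by (intro the1_equality[OF ex1_produced]) simp

section \<open>Riordan arrays\<close>

text \<open>Column \<open>k + 1\<close> has the generating function of column \<open>k\<close> times \<open>x \<psi>\<close>, which has no constant
  term; deleting its top entry divides by \<open>x\<close> and leaves a factor \<open>\<psi>\<close>.\<close>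

lemma drop_first_row_col_riordan_array:
  "drop_first_col (drop_top_row (riordan_array (g, fps_X * \<psi>))) =
   riordan_array (g * \<psi>, fps_X * \<psi>)"
proof (intro ext)
  fix n k
  have "g * (fps_X * \<psi>) ^ Suc k = fps_X * (g * \<psi> * (fps_X * \<psi>) ^ k)"
    by (simp only: power_Suc mult_ac)
  then have "(g * (fps_X * \<psi>) ^ Suc k) $ Suc n = (g * \<psi> * (fps_X * \<psi>) ^ k) $ n"
    by (simp only:) simp
  then show "drop_first_col (drop_top_row (riordan_array (g, fps_X * \<psi>))) n k =
      riordan_array (g * \<psi>, fps_X * \<psi>) n k"
    unfolding drop_first_col_def drop_top_row_def riordan_array_def prod.case .
qed

lemma row_finite_riordan_array: "f $ 0 = 0 \<Longrightarrow> row_finite (riordan_array (g, f))"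
  by (intro lower_triangular_imp_row_finite riordan_array_lower_triangular)

lemma riordan_array_mult_inverse:
  assumes "riordan_pair (g, f)"
  shows "mat_mult (riordan_array (g, f)) (mat_inverse (riordan_array (g, f))) = mat_one"
proof -
  define h where "h = fps_inv f"
  have g: "g $ 0 \<noteq> 0" and f: "f $ 0 = 0" "f $ 1 \<noteq> 0"
    using assms by (auto simp: riordan_pair_def)
  have h: "h $ 0 = 0" "h oo f = fps_X"
    using f by (simp add: h_def fps_inv_def, simp add: h_def fps_inv)
  have "inverse (g oo h) oo f = inverse ((g oo h) oo f)"
    using f g by (intro fps_inverse_compose) auto
  also have "(g oo h) oo f = g"
    using f h by (simp add: fps_compose_assoc[symmetric])
  finally have "g * (1 / (g oo h) oo f) = 1"
    using g by (simp add: fps_divide_unit inverse_mult_eq_1')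
  with f h show ?thesis
    by (simp add: mat_inverse_riordan_array[OF assms] riordan_inverse_def h_def[symmetric]
        riordan_array_mult riordan_array_one)
qed

section \<open>The matrix produced by the second production matrix\<close>

text \<open>The second production matrix skips two rows at each step, and its missing first column accounts
  for one of them. The substitution of the Lagrange series \<open>w = x \<phi>(w)\<close> accounts for the other: a
  further factor \<open>\<phi>(w) = w / x\<close> trades one power of \<open>w\<close> for one power of \<open>x\<close>.\<close>

theorem produced_second_production_matrix_lagrange:
  fixes g \<phi> w :: "'a::field fps"
  assumes unit: "g $ 0 * \<phi> $ 0 = 1" and w: "w = fps_X * (\<phi> oo w)"
  shows "produced (second_production_matrix (riordan_array (g, fps_X * \<phi>))) =
         riordan_array ((g * \<phi>) oo w, (fps_X * \<phi>) oo w)"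
proof -
  define f where "f = fps_X * \<phi>"
  define M where "M = riordan_array (g, f)"
  define D where "D = drop_top_row (riordan_array (g * \<phi>, f))"
  define X where "X = riordan_array ((g * \<phi>) oo w, f oo w)"
  define Y where "Y = riordan_array (\<phi> oo w, w)"
  have f0: "f $ 0 = 0" by (simp add: f_def)
  have w0: "w $ 0 = 0" by (subst w) simp
  have pair: "riordan_pair (g, f)" using unit by (auto simp: riordan_pair_def f_def)
  have rfM: "row_finite M" and rfY: "row_finite Y"
    using f0 w0 by (simp_all add: M_def Y_def row_finite_riordan_array)
  have rfM': "row_finite (mat_inverse M)"
    by (simp add: M_def mat_inverse_riordan_array[OF pair] riordan_inverse_def
        row_finite_riordan_array fps_inv_def)

  have "second_production_matrix M = mat_mult (mat_inverse M) D"
    unfolding second_production_matrix_def drop_first_col_mat_mult D_def M_def f_def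
      drop_first_row_col_riordan_array[symmetric]
    by (simp add: drop_first_col_def drop_top_row_def)
  moreover have "mat_mult X (mat_mult (mat_inverse M) D) = mat_mult Y D"
  proof -
    have "X = mat_mult Y M"
      using f0 w0 by (simp add: X_def Y_def M_def riordan_array_mult fps_compose_mult_distrib
          mult.commute)
    then have "mat_mult X (mat_mult (mat_inverse M) D) =
        mat_mult Y (mat_mult (mat_mult M (mat_inverse M)) D)"
      using rfM rfM' rfY by (simp add: mat_mult_assoc)
    then show ?thesis
      using riordan_array_mult_inverse[OF pair] by (simp add: M_def mat_mult_one_left)
  qed
  moreover have "mat_mult Y D = drop_top_row X"
  proof -
    have "Y = drop_first_col (drop_top_row (riordan_array (1, w)))"
      using drop_first_row_col_riordan_array[of 1 "\<phi> oo w"] by (simp add: Y_def flip: w)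
    moreover have "riordan_array (1, w) (Suc n) 0 = 0" for n
      by (simp add: riordan_array_def)
    ultimately have "mat_mult Y D =
        drop_top_row (mat_mult (riordan_array (1, w)) (riordan_array (g * \<phi>, f)))"
      using w0 by (simp add: D_def drop_top_row_mat_mult_shift row_finite_riordan_array)
    then show ?thesis using f0 w0 by (simp add: X_def riordan_array_mult)
  qed
  ultimately have "drop_top_row X = mat_mult X (second_production_matrix M)" by simp
  moreover have "X 0 = (\<lambda>k. if k = 0 then 1 else 0)"
    using unit f0 by (auto simp: X_def riordan_array_def fun_eq_iff fps_mult_nth_0)
  ultimately show ?thesis
    unfolding X_def M_def f_def by (rule produced_eqI[rotated])
qed

text \<open>Dividing by \<open>x\<close> turns the pair into products with the unit \<open>h\<^sub>1 = h / x\<close>, where \<open>h\<close> is the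
  compositional inverse of \<open>f\<close>. Composing with \<open>F\<close>, the Lagrange series is
  \<open>w = h(F) = F h\<^sub>1(F)\<close>, and \<open>h\<^sub>1(F)\<close> is the reciprocal of \<open>\<phi>(w)\<close> because \<open>w \<phi>(w) = f(w) = F\<close>.\<close>

lemma riordan_inverse_lagrange:
  fixes g \<phi> :: "'a::field fps"
  assumes g: "g $ 0 \<noteq> 0" and \<phi>: "\<phi> $ 0 \<noteq> 0"
  defines "f \<equiv> fps_X * \<phi>"
  defines "h \<equiv> fps_inv f"
  defines "p \<equiv> (h / (fps_X * (g oo h)), h ^ 2 / fps_X)"
  obtains w where "riordan_pair p" "w = fps_X * (\<phi> oo w)"
    "riordan_inverse p = ((g * \<phi>) oo w, f oo w)"
proof -
  have f: "f $ 0 = 0" "f $ 1 \<noteq> 0" using \<phi> by (simp_all add: f_def)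
  have h0: "h $ 0 = 0" by (simp add: h_def fps_inv_def)
  have fh: "f oo h = fps_X" using f by (simp add: h_def fps_inv_right)
  define h1 where "h1 = fps_shift 1 h"
  have h: "h = fps_X * h1"
    using h0 by (intro fps_ext) (auto simp: h1_def)
  have h1: "h1 $ 0 \<noteq> 0"
  proof
    assume "h1 $ 0 = 0"
    then have "h $ 1 = 0" by (simp add: h)
    have "(f oo h) $ 1 = 0"
      using f h0 \<open>h $ 1 = 0\<close> by (simp add: fps_compose_nth)
    then show False by (simp add: fh)
  qed
  define a where "a = h1 * inverse (g oo h)"
  define b where "b = fps_X * h1 ^ 2"
  have gh: "(g oo h) $ 0 \<noteq> 0" using g by simp
  have "h / (fps_X * (g oo h)) = a"
  proof -
    have "h = a * (fps_X * (g oo h))"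
      using inverse_mult_eq_1[OF gh] by (subst h) (simp add: a_def mult_ac)
    moreover have "fps_X * (g oo h) \<noteq> 0"
      using gh by (metis fps_X_neq_zero fps_zero_nth mult_eq_0_iff)
    ultimately show ?thesis by (metis nonzero_mult_div_cancel_right)
  qed
  moreover have "h ^ 2 / fps_X = b"
  proof -
    have "h ^ 2 = b * fps_X" by (simp add: h b_def power2_eq_square mult_ac)
    then show ?thesis by (metis fps_X_neq_zero nonzero_mult_div_cancel_right)
  qed
  ultimately have p: "p = (a, b)" by (simp add: p_def)
  have a0: "a $ 0 \<noteq> 0" using g h1 by (simp add: a_def)
  have b: "b $ 0 = 0" "b $ 1 \<noteq> 0" using h1 by (simp_all add: b_def power2_eq_square)
  have pair: "riordan_pair p" using a0 b by (simp add: riordan_pair_def p)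

  define F where "F = fps_inv b"
  define w where "w = h oo F"
  have F0: "F $ 0 = 0" by (simp add: F_def fps_inv_def)
  have bF: "b oo F = fps_X" using b by (simp add: F_def fps_inv_right)
  then have "F \<noteq> 0" using b by auto
  have w0: "w $ 0 = 0" by (simp add: w_def h0)
  have fw: "f oo w = F"
    using fh h0 F0 by (simp add: w_def fps_compose_assoc)
  then have F: "F = w * (\<phi> oo w)"
    using w0 by (simp add: f_def fps_compose_mult_distrib)
  have w_h1: "w = F * (h1 oo F)"
    using F0 by (simp add: w_def h fps_compose_mult_distrib)
  have "F * (h1 oo F) ^ 2 = fps_X"
    using bF F0 by (simp add: b_def fps_compose_mult_distrib fps_compose_power)
  then have "w * w = fps_X * (w * (\<phi> oo w))"
    unfolding F[symmetric] by (subst (1 2) w_h1) (simp add: power2_eq_square mult_ac)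
  moreover have "w \<noteq> 0" using F \<open>F \<noteq> 0\<close> by auto
  ultimately have w: "w = fps_X * (\<phi> oo w)"
    by (metis mult.left_commute mult_cancel_left)
  have "F * ((h1 oo F) * (\<phi> oo w)) = F * 1"
    using F w_h1 by (metis mult.assoc mult_1_right)
  then have recip: "(h1 oo F) * (\<phi> oo w) = 1"
    using \<open>F \<noteq> 0\<close> mult_cancel_left by blast
  have ghF: "(g oo h) oo F = g oo w"
    using h0 F0 by (simp add: w_def fps_compose_assoc)
  have "a oo F = (h1 oo F) * inverse (g oo w)"
    using F0 gh ghF by (simp add: a_def fps_compose_mult_distrib fps_inverse_compose)
  moreover have "inverse (g oo w) * (g oo w) = 1"
    using g by (intro inverse_mult_eq_1) simp
  ultimately have "((g * \<phi>) oo w) * (a oo F) = 1"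
    using recip w0 by (simp add: fps_compose_mult_distrib mult_ac)
  moreover have "a oo F \<noteq> 0" using calculation by auto
  ultimately have "1 / (a oo F) = (g * \<phi>) oo w"
    by (metis nonzero_mult_div_cancel_right)
  then have "riordan_inverse p = ((g * \<phi>) oo w, f oo w)"
    by (simp add: riordan_inverse_def p fw flip: F_def)
  with pair w show thesis by (rule that)
qed

theorem proposition2:
  fixes g f :: "complex fps"
  assumes "g $ 0 = 1" and "f $ 0 = 0" and "f $ 1 = 1"
  shows "let M = riordan_array (g, f);
             fbar = fps_inv f;
             p = (fbar / (fps_X * (g oo fbar)), fbar ^ 2 / fps_X)
         in riordan_pair p \<and>
            produced (second_production_matrix M) = riordan_array (riordan_inverse p)"
proof -
  define \<phi> where "\<phi> = fps_shift 1 f"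
  have f: "f = fps_X * \<phi>"
    using assms(2) by (intro fps_ext) (auto simp: \<phi>_def)
  have \<phi>: "\<phi> $ 0 = 1" using assms(3) by (simp add: \<phi>_def)
  obtain w where "riordan_pair (fps_inv f / (fps_X * (g oo fps_inv f)), (fps_inv f)\<^sup>2 / fps_X)"
    and w: "w = fps_X * (\<phi> oo w)"
    and "riordan_inverse (fps_inv f / (fps_X * (g oo fps_inv f)), (fps_inv f)\<^sup>2 / fps_X) =
         ((g * \<phi>) oo w, f oo w)"
    using riordan_inverse_lagrange[of g \<phi>] assms(1) \<phi> unfolding f by auto
  moreover have "produced (second_production_matrix (riordan_array (g, f))) =
      riordan_array ((g * \<phi>) oo w, f oo w)"
    unfolding f using assms(1) \<phi> w
    by (intro produced_second_production_matrix_lagrange) simp_all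
  ultimately show ?thesis by (simp add: Let_def)
qed

end
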